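(* Let $\Delta t>0$ and let $\phi^{n-1},\phi^n$ and $r^n\in\mathbb{R}$ be given, with $\widehat{\phi}^{n+\frac12}=\frac32\phi^n-\frac12\phi^{n-1}$. Suppose $\phi^{n+1}$, $\mu^{n+\frac12}$ and $r^{n+1}\in\mathbb{R}$ satisfy the second-order Crank-Nicolson scalar auxiliary variable (SAV) scheme $$\frac{\phi^{n+1}-\phi^n}{\Delta t}=-\mathcal{G}\mu^{n+\frac12},$$ $$\mu^{n+\frac12}=\tfrac12\mathcal{L}\phi^{n+1}+\tfrac12\mathcal{L}\phi^{n}+\frac{r^{n+\frac12}}{\sqrt{E_1(\widehat{\phi}^{n+\frac12})+C}}F'(\widehat{\phi}^{n+\frac12}),$$ $$\frac{r^{n+1}-r^n}{\Delta t}=\frac{1}{2\sqrt{E_1(\widehat{\phi}^{n+\frac12})+C}}\left(F'(\widehat{\phi}^{n+\frac12}),\frac{\phi^{n+1}-\phi^n}{\Delta t}\right),$$ where $r^{n+\frac12}=(r^{n+1}+r^n)/2$. Then $$\phi^{n+1}=\overline{\phi}^{n+1}+\left(\frac{r^{n+\frac12}}{\sqrt{E_1(\widehat{\phi}^{n+\frac12})+C}}-1\right)q^{n+1},$$ where, with $A=I+\frac12\Delta t\,\mathcal{G}\mathcal{L}$, $$\overline{\phi}^{n+1}=A^{-1}\left[(I-\tfrac12\Delta t\,\mathcal{G}\mathcal{L})\phi^{n}-\Delta t\,\mathcal{G}F'(\widehat{\phi}^{n+\frac12})\right],\qquad q^{n+1}=-\Delta t\,A^{-1}\mathcal{G}F'(\widehat{\phi}^{n+\frac12}).$$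 That is, the SAV solution has the form $\phi^{n+1}=\overline{\phi}^{n+1}+\mathcal{P}\,q^{n+1}$ of the Crank-Nicolson zero-factor scheme, with the specific zero factor $\mathcal{P}=\frac{r}{\sqrt{E_1(\phi)+C}}-1$, discretized as $\mathcal{P}=\frac{r^{n+\frac12}}{\sqrt{E_1(\widehat{\phi}^{n+\frac12})+C}}-1$.
   Context: $(\cdot,\cdot)$ is the $L^2(\Omega)$ inner product (e.g. on a periodic domain $\Omega$). $\mathcal{L}$ is a symmetric non-negative linear operator, $\mathcal{G}$ is a positive linear operator (e.g. $I$ or $-\Delta$), and $A=I+\frac12\Delta t\,\mathcal{G}\mathcal{L}$ is symmetric positive, hence invertible. $F$ is a differentiable real function applied pointwise, $E_1(\phi)=(F(\phi),1)=\int_\Omega F(\phi)\,d\mathbf{x}$, and $C$ is a constant with $E_1(\widehat{\phi}^{n+\frac12})+C>0$. All functions are assumed regular enough for every expression to be defined. In the Crank-Nicolson zero-factor scheme, the chemical potential is $\mu^{n+\frac12}=\frac12\mathcal{L}\phi^{n+1}+\frac12\mathcal{L}\phi^n+[1+\mathcal{P}]F'(\widehat{\phi}^{n+\frac12})$ with a real number $\mathcal{P}$ (the zero factor), and its solution is $\phi^{n+1}=\overline{\phi}^{n+1}+\mathcal{P}\,q^{n+1}$; $\overline{\phi}^{n+1}$ is the solution of the baseline semi-implicit Crank-Nicolson scheme. *)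

theory Defs
  imports "HOL-Analysis.Analysis"
begin

text \<open>
  A real function on \<open>\<Omega>\<close> is represented by its extension by zero to the whole Euclidean space,
  so that equality of functions on \<open>\<Omega>\<close> is HOL equality. A periodic domain is represented by a
  fundamental cell \<open>\<Omega>\<close>; periodicity then enters through the choice of the function space \<open>X\<close> and
  of the domains of the operators.
\<close>

definition fun_subspace :: "('a \<Rightarrow> real) set \<Rightarrow> bool" where
  "fun_subspace V \<longleftrightarrow>
     (\<lambda>x. 0) \<in> V \<and>
     (\<forall>f\<in>V. \<forall>g\<in>V. (\<lambda>x. f x + g x) \<in> V) \<and>
     (\<forall>c. \<forall>f\<in>V. (\<lambda>x. c * f x) \<in> V)"

definition L2_functions :: "'a::euclidean_space set \<Rightarrow> ('a \<Rightarrow> real) set" where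
  "L2_functions \<Omega> =
     {f. (\<forall>x. x \<notin> \<Omega> \<longrightarrow> f x = 0) \<and> f \<in> borel_measurable lebesgue \<and>
         integrable lebesgue (\<lambda>x. (f x)\<^sup>2)}"

definition L2_inner :: "'a::euclidean_space set \<Rightarrow> ('a \<Rightarrow> real) \<Rightarrow> ('a \<Rightarrow> real) \<Rightarrow> real" where
  "L2_inner \<Omega> f g = (LINT x:\<Omega>|lebesgue. f x * g x)"

text \<open>Operators may be unbounded: \<open>T\<close> is only constrained on its domain \<open>D \<subseteq> X\<close>.\<close>

definition linear_operator ::
    "('a \<Rightarrow> real) set \<Rightarrow> ('a \<Rightarrow> real) set \<Rightarrow> (('a \<Rightarrow> real) \<Rightarrow> ('a \<Rightarrow> real)) \<Rightarrow> bool" where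
  "linear_operator X D T \<longleftrightarrow>
     fun_subspace D \<and> D \<subseteq> X \<and> T ` D \<subseteq> X \<and>
     (\<forall>f\<in>D. \<forall>g\<in>D. T (\<lambda>x. f x + g x) = (\<lambda>x. T f x + T g x)) \<and>
     (\<forall>c. \<forall>f\<in>D. T (\<lambda>x. c * f x) = (\<lambda>x. c * T f x))"

definition symmetric_operator ::
    "'a::euclidean_space set \<Rightarrow> ('a \<Rightarrow> real) set \<Rightarrow> (('a \<Rightarrow> real) \<Rightarrow> ('a \<Rightarrow> real)) \<Rightarrow> bool" where
  "symmetric_operator \<Omega> D T \<longleftrightarrow> (\<forall>f\<in>D. \<forall>g\<in>D. L2_inner \<Omega> (T f) g = L2_inner \<Omega> f (T g))"

definition nonneg_operator ::
    "'a::euclidean_space set \<Rightarrow> ('a \<Rightarrow> real) set \<Rightarrow> (('a \<Rightarrow> real) \<Rightarrow> ('a \<Rightarrow> real)) \<Rightarrow> bool" where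
  "nonneg_operator \<Omega> D T \<longleftrightarrow> (\<forall>f\<in>D. 0 \<le> L2_inner \<Omega> (T f) f)"

definition posdef_operator ::
    "'a::euclidean_space set \<Rightarrow> ('a \<Rightarrow> real) set \<Rightarrow> (('a \<Rightarrow> real) \<Rightarrow> ('a \<Rightarrow> real)) \<Rightarrow> bool" where
  "posdef_operator \<Omega> D T \<longleftrightarrow> (\<forall>f\<in>D. f \<noteq> (\<lambda>x. 0) \<longrightarrow> 0 < L2_inner \<Omega> (T f) f)"

definition pointwise :: "'a set \<Rightarrow> (real \<Rightarrow> real) \<Rightarrow> ('a \<Rightarrow> real) \<Rightarrow> 'a \<Rightarrow> real" where
  "pointwise \<Omega> h \<phi> = (\<lambda>x. if x \<in> \<Omega> then h (\<phi> x) else 0)"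

definition E1 :: "'a::euclidean_space set \<Rightarrow> (real \<Rightarrow> real) \<Rightarrow> ('a \<Rightarrow> real) \<Rightarrow> real" where
  "E1 \<Omega> F \<phi> = (LINT x:\<Omega>|lebesgue. F (\<phi> x))"

definition CN_operator ::
    "real \<Rightarrow> (('a \<Rightarrow> real) \<Rightarrow> ('a \<Rightarrow> real)) \<Rightarrow> (('a \<Rightarrow> real) \<Rightarrow> ('a \<Rightarrow> real)) \<Rightarrow>
     ('a \<Rightarrow> real) \<Rightarrow> ('a \<Rightarrow> real)" where
  "CN_operator \<Delta>t G L \<phi> = (\<lambda>x. \<phi> x + 1/2 * \<Delta>t * G (L \<phi>) x)"

definition CN_domain ::
    "('a \<Rightarrow> real) set \<Rightarrow> ('a \<Rightarrow> real) set \<Rightarrow> (('a \<Rightarrow> real) \<Rightarrow> ('a \<Rightarrow> real)) \<Rightarrow> ('a \<Rightarrow> real) set" where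
  "CN_domain DG DL L = {\<phi> \<in> DL. L \<phi> \<in> DG}"

text \<open>
  One step \<open>\<phi>\<^sub>0 \<mapsto> \<phi>\<^sub>1\<close> of the Crank-Nicolson zero-factor scheme with zero factor \<open>P\<close> and
  extrapolated state \<open>\<phi>h\<close>; the case \<open>P = 0\<close> is the baseline semi-implicit scheme.
\<close>

definition CN_zero_factor_step ::
    "'a set \<Rightarrow> real \<Rightarrow> ('a \<Rightarrow> real) set \<Rightarrow> (('a \<Rightarrow> real) \<Rightarrow> ('a \<Rightarrow> real)) \<Rightarrow>
     ('a \<Rightarrow> real) set \<Rightarrow> (('a \<Rightarrow> real) \<Rightarrow> ('a \<Rightarrow> real)) \<Rightarrow> (real \<Rightarrow> real) \<Rightarrow> real \<Rightarrow>
     ('a \<Rightarrow> real) \<Rightarrow> ('a \<Rightarrow> real) \<Rightarrow> ('a \<Rightarrow> real) \<Rightarrow> ('a \<Rightarrow> real) \<Rightarrow> bool" where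
  "CN_zero_factor_step \<Omega> \<Delta>t DG G DL L F P \<phi>\<^sub>0 \<phi>h \<phi>\<^sub>1 \<mu> \<longleftrightarrow>
     \<phi>\<^sub>1 \<in> DL \<and> \<mu> \<in> DG \<and>
     (\<forall>x\<in>\<Omega>. (\<phi>\<^sub>1 x - \<phi>\<^sub>0 x) / \<Delta>t = - G \<mu> x) \<and>
     (\<forall>x\<in>\<Omega>. \<mu> x = 1/2 * L \<phi>\<^sub>1 x + 1/2 * L \<phi>\<^sub>0 x + (1 + P) * deriv F (\<phi>h x))"

end

(* Substituting the chemical potential into the evolution equation turns a Crank-Nicolson step with
   zero factor P into the single linear equation A phi1 = b - (1 + P) dt G f, with b independent
   of P. The right-hand side is affine in P and A is linear and injective, so the solution is affine
   in P: phi1 = phibar + P q. The SAV step is the zero-factor step with P = rh / S - 1. *)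
theory Submission
  imports Defs
begin

lemma fun_subspace_lincomb:
  assumes "fun_subspace V" "f \<in> V" "g \<in> V"
  shows "(\<lambda>x. a * f x + b * g x) \<in> V"
proof -
  have "(\<lambda>x. a * f x) \<in> V" "(\<lambda>x. b * g x) \<in> V"
    using assms unfolding fun_subspace_def by blast+
  moreover have "(\<lambda>x. u x + v x) \<in> V" if "u \<in> V" "v \<in> V" for u v
    using assms(1) that unfolding fun_subspace_def by blast
  ultimately show ?thesis
    by blast
qed

lemma linear_operator_subspace: "linear_operator X D T \<Longrightarrow> fun_subspace D"
  by (simp add: linear_operator_def)

lemma linear_operator_domain: "linear_operator X D T \<Longrightarrow> f \<in> D \<Longrightarrow> f \<in> X"
  unfolding linear_operator_def by blast

lemma linear_operator_range: "linear_operator X D T \<Longrightarrow> f \<in> D \<Longrightarrow> T f \<in> X"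
  unfolding linear_operator_def by blast

lemma linear_operator_lincomb:
  assumes "linear_operator X D T" "f \<in> D" "g \<in> D"
  shows "T (\<lambda>x. a * f x + b * g x) = (\<lambda>x. a * T f x + b * T g x)"
proof -
  have add: "T (\<lambda>x. u x + v x) = (\<lambda>x. T u x + T v x)" if "u \<in> D" "v \<in> D" for u v
    using assms(1) that unfolding linear_operator_def by blast
  have scale: "T (\<lambda>x. c * u x) = (\<lambda>x. c * T u x)" if "u \<in> D" for c u
    using assms(1) that unfolding linear_operator_def by blast
  have "(\<lambda>x. a * f x) \<in> D" "(\<lambda>x. b * g x) \<in> D"
    using assms unfolding linear_operator_def fun_subspace_def by blast+
  with add scale assms(2,3) show ?thesis
    by simp
qed

text \<open>Since \<open>L\<close> sends a linear combination to the same combination of images, the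
  condition \<open>L f \<in> DG\<close> inherits closure from \<open>DG\<close>. This places
  \<phi>bar + P q in the set on which the main proof can use injectivity of the Crank-Nicolson
  operator.\<close>

lemma fun_subspace_CN_domain:
  assumes L: "linear_operator X DL L" and G: "linear_operator X DG G"
  shows "fun_subspace (CN_domain DG DL L)"
proof -
  note DL = linear_operator_subspace[OF L] and DG = linear_operator_subspace[OF G]
  have lincomb: "(\<lambda>x. a * f x + b * g x) \<in> CN_domain DG DL L"
    if "f \<in> CN_domain DG DL L" "g \<in> CN_domain DG DL L" for a b f g
    using that fun_subspace_lincomb[OF DL] fun_subspace_lincomb[OF DG]
    by (simp add: CN_domain_def linear_operator_lincomb[OF L])
  have zero_DL: "(\<lambda>x. 0) \<in> DL"
    using DL by (simp add: fun_subspace_def)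
  \<comment> \<open>Both coefficients are chosen as 0, so linearity on \<open>DL\<close> gives the
    value at the zero function.\<close>
  have "L (\<lambda>x. 0) = (\<lambda>x. 0)"
    using linear_operator_lincomb[OF L zero_DL zero_DL, of 0 0] by simp
  then have zero: "(\<lambda>x. 0) \<in> CN_domain DG DL L"
    using zero_DL DG by (simp add: CN_domain_def fun_subspace_def)
  show ?thesis
    unfolding fun_subspace_def
  proof (intro conjI ballI allI)
    fix f g assume "f \<in> CN_domain DG DL L" "g \<in> CN_domain DG DL L"
    then show "(\<lambda>x. f x + g x) \<in> CN_domain DG DL L"
      using lincomb[of f g 1 1] by simp
  next
    fix c f assume "f \<in> CN_domain DG DL L"
    then show "(\<lambda>x. c * f x) \<in> CN_domain DG DL L"
      using lincomb[of f f c 0] by simp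
  qed (rule zero)
qed

lemma CN_operator_lincomb:
  assumes L: "linear_operator X DL L" and G: "linear_operator X DG G"
    and f: "f \<in> CN_domain DG DL L" and g: "g \<in> CN_domain DG DL L"
  shows "CN_operator dt G L (\<lambda>x. a * f x + b * g x)
       = (\<lambda>x. a * CN_operator dt G L f x + b * CN_operator dt G L g x)"
proof -
  have "G (L (\<lambda>x. a * f x + b * g x)) = (\<lambda>x. a * G (L f) x + b * G (L g) x)"
    using f g by (simp add: CN_domain_def linear_operator_lincomb[OF L] linear_operator_lincomb[OF G])
  then show ?thesis
    by (simp add: CN_operator_def algebra_simps)
qed

text \<open>The scheme speaks only about points of \<Omega>, but all functions involved vanish
  elsewhere, so its equations hold as identities of functions and \<nu> can be eliminated. As an
  equivalence with an explicit formula for \<nu>, it serves both to analyse a given SAV step and to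
  show that the baseline step exists and is unique.\<close>

lemma CN_zero_factor_step_iff:
  assumes X: "X \<subseteq> L2_functions \<Omega>"
    and L: "linear_operator X DL L" and G: "linear_operator X DG G"
    and dt: "dt > 0"
    and u: "u \<in> CN_domain DG DL L"
    and f: "f \<in> DG" and f_eq: "f = pointwise \<Omega> (deriv F) h"
  shows "CN_zero_factor_step \<Omega> dt DG G DL L F P u h v \<nu> \<longleftrightarrow>
           v \<in> CN_domain DG DL L \<and>
           \<nu> = (\<lambda>x. 1/2 * L v x + 1/2 * L u x + (1 + P) * f x) \<and>
           CN_operator dt G L v
             = (\<lambda>x. (u x - 1/2 * dt * G (L u) x) - (1 + P) * (dt * G f x))"
    (is "?step \<longleftrightarrow> ?v \<and> ?\<nu> \<and> ?A")
proof -
  note lin = fun_subspace_lincomb[OF linear_operator_subspace[OF G]]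
  note Glin = linear_operator_lincomb[OF G]
  have outside: "w x = 0" if "w \<in> X" "x \<notin> \<Omega>" for w x
    using X that by (auto simp: L2_functions_def)
  have uL: "u \<in> DL" and Lu: "L u \<in> DG"
    using u by (auto simp: CN_domain_def)
  note in_X = linear_operator_domain[OF L] linear_operator_range[OF L]
    linear_operator_domain[OF G] linear_operator_range[OF G]
  \<comment> \<open>Off \<Omega> the identity reads 0 = 0, because \<open>v\<close>,
    \<open>u\<close> and \<open>G \<nu>\<close> lie in \<open>X\<close>. The same argument extends
    the equation for the potential below.\<close>
  have evolution: "(\<forall>x\<in>\<Omega>. (v x - u x) / dt = - G \<nu> x) \<longleftrightarrow> v = (\<lambda>x. u x - dt * G \<nu> x)"
    if "v \<in> DL" "\<nu> \<in> DG"
  proof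
    assume eq: "\<forall>x\<in>\<Omega>. (v x - u x) / dt = - G \<nu> x"
    show "v = (\<lambda>x. u x - dt * G \<nu> x)"
    proof
      fix x show "v x = u x - dt * G \<nu> x"
      proof (cases "x \<in> \<Omega>")
        case True
        with eq dt show ?thesis by (simp add: field_simps)
      qed (simp add: outside in_X that uL)
    qed
  next
    assume v: "v = (\<lambda>x. u x - dt * G \<nu> x)"
    show "\<forall>x\<in>\<Omega>. (v x - u x) / dt = - G \<nu> x"
      using dt fun_cong[OF v] by (simp add: field_simps)
  qed
  have potential: "(\<forall>x\<in>\<Omega>. \<nu> x = 1/2 * L v x + 1/2 * L u x + (1 + P) * deriv F (h x)) \<longleftrightarrow> ?\<nu>"
    if "v \<in> DL" "\<nu> \<in> DG"
  proof
    assume eq: "\<forall>x\<in>\<Omega>. \<nu> x = 1/2 * L v x + 1/2 * L u x + (1 + P) * deriv F (h x)"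
    show ?\<nu>
    proof
      fix x show "\<nu> x = 1/2 * L v x + 1/2 * L u x + (1 + P) * f x"
      proof (cases "x \<in> \<Omega>")
        case True
        with eq show ?thesis by (simp add: f_eq pointwise_def)
      qed (simp add: outside in_X that uL f)
    qed
  qed (simp add: f_eq pointwise_def)
  \<comment> \<open>A step only provides \<open>\<nu> \<in> DG\<close>. Solving the potential
    equation for \<open>L v\<close> gives 2 \<nu> - L u - 2 (1 + P) f, a combination of elements of
    \<open>DG\<close>.\<close>
  have Lv_DG: "L v \<in> DG" if "\<nu> \<in> DG" ?\<nu>
  proof -
    have "(\<lambda>x. 1 * (2 * \<nu> x + - 1 * L u x) + (- 2 * (1 + P)) * f x) \<in> DG"
      by (intro lin that Lu f)
    also have "(\<lambda>x. 1 * (2 * \<nu> x + - 1 * L u x) + (- 2 * (1 + P)) * f x) = L v"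
      by (subst that(2)) (simp add: algebra_simps)
    finally show ?thesis .
  qed
  have \<nu>_DG: "\<nu> \<in> DG" if "L v \<in> DG" ?\<nu>
    using lin[OF lin[OF that(1) Lu, of "1/2" "1/2"] f, of 1 "1 + P"] that(2) by simp
  \<comment> \<open>\<open>G\<close> is linear only on \<open>DG\<close>, so it may be split over
    the three terms only once \<open>L v \<in> DG\<close> is known.\<close>
  have G\<nu>: "G \<nu> = (\<lambda>x. 1/2 * G (L v) x + 1/2 * G (L u) x + (1 + P) * G f x)"
    if "L v \<in> DG" ?\<nu>
    using Glin[OF lin[OF that(1) Lu, of "1/2" "1/2"] f, of 1 "1 + P"]
      Glin[OF that(1) Lu, of "1/2" "1/2"] that(2) by simp
  \<comment> \<open>Moving the implicit half dt/2 G L v to the left produces the Crank-Nicolson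
    operator; the explicit half stays on the right.\<close>
  have linear_system: "v = (\<lambda>x. u x - dt * G \<nu> x) \<longleftrightarrow> ?A" if "L v \<in> DG" ?\<nu>
    unfolding G\<nu>[OF that] CN_operator_def fun_eq_iff by (simp add: algebra_simps)
  show ?thesis
    unfolding CN_zero_factor_step_def CN_domain_def mem_Collect_eq
    using evolution potential Lv_DG \<nu>_DG linear_system by blast
qed

theorem mainTheorem2:
  fixes \<Omega> :: "'a::euclidean_space set"
    and X DG DL :: "('a \<Rightarrow> real) set"
    and G L A :: "('a \<Rightarrow> real) \<Rightarrow> ('a \<Rightarrow> real)"
    and F :: "real \<Rightarrow> real"
    and \<Delta>t C r\<^sub>0 r\<^sub>1 rh S P :: real
    and \<phi>m \<phi>\<^sub>0 \<phi>\<^sub>1 \<phi>h \<mu> f \<phi>bar q :: "'a \<Rightarrow> real"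
  assumes "\<Omega> \<in> sets lebesgue"
    and "fun_subspace X" and "X \<subseteq> L2_functions \<Omega>"
    and "linear_operator X DL L" and "symmetric_operator \<Omega> DL L" and "nonneg_operator \<Omega> DL L"
    and "linear_operator X DG G" and "nonneg_operator \<Omega> DG G"
    and "0 < \<Delta>t"
    and A_def: "A = CN_operator \<Delta>t G L"
    and "symmetric_operator \<Omega> (CN_domain DG DL L) A"
    and "posdef_operator \<Omega> (CN_domain DG DL L) A"
    and "bij_betw A (CN_domain DG DL L) X"
    and "\<forall>s. F differentiable (at s)"
    and "\<phi>m \<in> X" and "\<phi>\<^sub>0 \<in> CN_domain DG DL L"
    and \<phi>h_def: "\<phi>h = (\<lambda>x. 3/2 * \<phi>\<^sub>0 x - 1/2 * \<phi>m x)"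
    and "set_integrable lebesgue \<Omega> (\<lambda>x. F (\<phi>h x))"
    and "0 < E1 \<Omega> F \<phi>h + C"
    and S_def: "S = sqrt (E1 \<Omega> F \<phi>h + C)"
    and f_def: "f = pointwise \<Omega> (deriv F) \<phi>h"
    and "f \<in> DG"
    and "\<phi>\<^sub>1 \<in> DL" and "\<mu> \<in> DG"
    and rh_def: "rh = (r\<^sub>1 + r\<^sub>0) / 2"
    and sav_phi: "\<forall>x\<in>\<Omega>. (\<phi>\<^sub>1 x - \<phi>\<^sub>0 x) / \<Delta>t = - G \<mu> x"
    and sav_mu: "\<forall>x\<in>\<Omega>. \<mu> x = 1/2 * L \<phi>\<^sub>1 x + 1/2 * L \<phi>\<^sub>0 x + rh / S * f x"
    and sav_r: "(r\<^sub>1 - r\<^sub>0) / \<Delta>t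
                  = 1 / (2 * S) * L2_inner \<Omega> f (\<lambda>x. (\<phi>\<^sub>1 x - \<phi>\<^sub>0 x) / \<Delta>t)"
    and \<phi>bar_def: "\<phi>bar = inv_into (CN_domain DG DL L) A
                  (\<lambda>x. (\<phi>\<^sub>0 x - 1/2 * \<Delta>t * G (L \<phi>\<^sub>0) x) - \<Delta>t * G f x)"
    and q_def: "q = (\<lambda>x. - \<Delta>t * inv_into (CN_domain DG DL L) A (G f) x)"
    and P_def: "P = rh / S - 1"
  shows "\<phi>\<^sub>1 = (\<lambda>x. \<phi>bar x + P * q x)
       \<and> CN_zero_factor_step \<Omega> \<Delta>t DG G DL L F P \<phi>\<^sub>0 \<phi>h \<phi>\<^sub>1 \<mu>
       \<and> (\<forall>\<psi>. (\<exists>\<nu>. CN_zero_factor_step \<Omega> \<Delta>t DG G DL L F 0 \<phi>\<^sub>0 \<phi>h \<psi> \<nu>) \<longleftrightarrow> \<psi> = \<phi>bar)"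
proof -
  let ?D = "CN_domain DG DL L"
  let ?b = "\<lambda>x. \<phi>\<^sub>0 x - 1/2 * \<Delta>t * G (L \<phi>\<^sub>0) x"
  note L = \<open>linear_operator X DL L\<close> and G = \<open>linear_operator X DG G\<close>
  note bij = \<open>bij_betw A ?D X\<close> and X = \<open>fun_subspace X\<close>
  note step_iff = CN_zero_factor_step_iff[OF \<open>X \<subseteq> L2_functions \<Omega>\<close> L G \<open>0 < \<Delta>t\<close>
      \<open>\<phi>\<^sub>0 \<in> ?D\<close> \<open>f \<in> DG\<close> f_def, folded A_def]

  \<comment> \<open>\<open>inv_into\<close> is a genuine inverse of \<open>A\<close> only on the
    image \<open>X\<close>, so the right-hand sides of both solves are first shown to lie
    there.\<close>
  have GfX: "G f \<in> X"
    using G \<open>f \<in> DG\<close> by (rule linear_operator_range)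
  have "\<phi>\<^sub>0 \<in> X" and "G (L \<phi>\<^sub>0) \<in> X"
    using \<open>\<phi>\<^sub>0 \<in> ?D\<close> linear_operator_domain[OF L] linear_operator_range[OF G]
    by (auto simp: CN_domain_def)
  then have rhsX: "(\<lambda>x. ?b x - \<Delta>t * G f x) \<in> X"
    using fun_subspace_lincomb[OF X fun_subspace_lincomb[OF X, of \<phi>\<^sub>0 "G (L \<phi>\<^sub>0)" 1 "- (1/2 * \<Delta>t)"]
        GfX, of 1 "- \<Delta>t"] by simp

  have inv_D: "inv_into ?D A w \<in> ?D" and A_inv: "A (inv_into ?D A w) = w" if "w \<in> X" for w
    using bij that by (auto simp: bij_betw_def intro: inv_into_into f_inv_into_f)
  have A_inj: "v = w" if "A v = A w" "v \<in> ?D" "w \<in> ?D" for v w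
    using bij that by (auto simp: bij_betw_def dest: inj_onD)
  have bar_D: "\<phi>bar \<in> ?D" and A_bar: "A \<phi>bar = (\<lambda>x. ?b x - \<Delta>t * G f x)"
    unfolding \<phi>bar_def using inv_D[OF rhsX] A_inv[OF rhsX] by blast+

  \<comment> \<open>The choice of \<open>P\<close> makes 1 + P equal to the SAV coefficient
    \<open>rh / S\<close>, and \<open>f\<close> agrees with \<open>deriv F (\<phi>h x)\<close> on
    \<Omega>.\<close>
  have step: "CN_zero_factor_step \<Omega> \<Delta>t DG G DL L F P \<phi>\<^sub>0 \<phi>h \<phi>\<^sub>1 \<mu>"
    using \<open>\<phi>\<^sub>1 \<in> DL\<close> \<open>\<mu> \<in> DG\<close> sav_phi sav_mu
    by (simp add: CN_zero_factor_step_def P_def f_def pointwise_def)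
  then have \<phi>\<^sub>1_D: "\<phi>\<^sub>1 \<in> ?D" and A_\<phi>\<^sub>1: "A \<phi>\<^sub>1 = (\<lambda>x. ?b x - (1 + P) * (\<Delta>t * G f x))"
    by (simp_all only: step_iff)

  \<comment> \<open>Here q = -\<Delta>t p, so P q enters the combination below as p with coefficient
    -(P \<Delta>t).\<close>
  define p where "p = inv_into ?D A (G f)"
  have p_D: "p \<in> ?D" and A_p: "A p = G f"
    unfolding p_def using inv_D[OF GfX] A_inv[OF GfX] by blast+
  have "(\<lambda>x. \<phi>bar x + P * q x) = (\<lambda>x. 1 * \<phi>bar x + (- (P * \<Delta>t)) * p x)" (is "_ = ?w")
    by (simp add: q_def p_def mult.assoc)
  moreover have "?w \<in> ?D"
    using fun_subspace_CN_domain[OF L G] bar_D p_D by (rule fun_subspace_lincomb)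
  \<comment> \<open>The term -\<Delta>t G f from \<open>\<phi>bar\<close> and -P \<Delta>t G f from
    p add up to -(1 + P) \<Delta>t G f.\<close>
  moreover have "A ?w = A \<phi>\<^sub>1"
    using CN_operator_lincomb[OF L G bar_D p_D, of \<Delta>t 1 "- (P * \<Delta>t)", folded A_def]
    unfolding A_\<phi>\<^sub>1 A_bar A_p by (simp add: algebra_simps)
  ultimately have form: "\<phi>\<^sub>1 = (\<lambda>x. \<phi>bar x + P * q x)"
    using A_inj \<phi>\<^sub>1_D by simp

  have "(\<exists>\<nu>. CN_zero_factor_step \<Omega> \<Delta>t DG G DL L F 0 \<phi>\<^sub>0 \<phi>h \<psi> \<nu>) \<longleftrightarrow> \<psi> = \<phi>bar" for \<psi>
  proof -
    \<comment> \<open>The formula for \<nu> discharges the existential quantifier, and for zero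
      factor 0 the remaining right-hand side is exactly \<open>A \<phi>bar\<close>.\<close>
    have "(\<exists>\<nu>. CN_zero_factor_step \<Omega> \<Delta>t DG G DL L F 0 \<phi>\<^sub>0 \<phi>h \<psi> \<nu>) \<longleftrightarrow> \<psi> \<in> ?D \<and> A \<psi> = A \<phi>bar"
      unfolding step_iff A_bar by simp
    also have "\<dots> \<longleftrightarrow> \<psi> = \<phi>bar"
      using A_inj bar_D by blast
    finally show ?thesis .
  qed
  with form step show ?thesis
    by blast
qed

end
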